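(* Let $(\mathcal{H},\mathscr{S})$ be a structured topological space. Suppose $\mathscr{B}\subseteq End(\mathcal{H})$ contains the identity and is closed under composition. Moreover suppose that for every $n$ and every $v\in\mathcal{H}^n$, the set $\{X^{\oplus n}v \mid X\in\mathscr{B}\}$ belongs to $\mathscr{S}$. Then $\overline{\mathscr{B}}=\mathscr{B}^{\tilde{''}}$, where $\overline{\mathscr{B}}$ is the closure of $\mathscr{B}$ in $Fun(\mathcal{H})$ and $\mathscr{B}^{\tilde{''}}$ is the set of equi-invariants of $\mathscr{B}$. Namely, if $End(\mathcal{H})$ is closed in $Fun(\mathcal{H})$, then $\mathscr{B}^{\tilde{''}}\subseteq End(\mathcal{H})$.
   Context: A structured topological space $(\mathcal{H},\mathscr{S})$ is a topological space $\mathcal{H}$ together with a structure $\mathscr{S}$, i.e. a collection of subsets of the finite powers $\mathcal{H}^n$, $n\ge 1$ (so $\mathscr{S}\subseteq\bigcup_n P(\mathcal{H}^n)$, $P$ = power set), such that (1) $S\in\mathscr{S}\Rightarrow\overline{S}\in\mathscr{S}$; (2) for each finite sequence of indices $i_1,\dots,i_n$ the block diagonal set $\{(v_{i_1},\dots,v_{i_n}) \mid v_i\in\mathcal{H}\}$ is in $\mathscr{S}$. $End(\mathcal{H})$ is the set of continuous maps $X:\mathcal{H}\to\mathcal{H}$ such that for all $m,n\ge 0$ and $S\in\mathscr{S}$ with $S\subseteq\mathcal{H}^{m+n+1}$ one has $(\mathrm{id}_{\mathcal{H}}^{\oplus m}\oplus X\oplus\mathrm{id}_{\mathcal{H}}^{\oplus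 n})S\in\mathscr{S}$. Here $\oplus$ of maps acts coordinatewise. $Fun(\mathcal{H})$ is the set of continuous maps $\mathcal{H}\to\mathcal{H}$ with the topology of pointwise convergence. For $\mathbb{X}\subseteq Fun(\mathcal{H})$, a set $S\subseteq\mathcal{H}^m$ is jointly invariant for $\mathbb{X}$ if $X^{\oplus m}S\subseteq S$ for all $X\in\mathbb{X}$; it is jointly invariant for $Y\in Fun(\mathcal{H})$ if it is so for $\{Y\}$. The equi-invariants $\mathbb{X}^{\tilde{''}}$ of $\mathbb{X}$ is the set of $Y\in Fun(\mathcal{H})$ such that, for every $m$, every closed set $S\subseteq\mathcal{H}^m$ that is jointly invariant for $\mathbb{X}$ is jointly invariant for $Y$. *)

theory Defs
  imports "HOL-Analysis.Analysis"
begin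

text \<open>
  The space H is an abstract topology \<open>T\<close> with underlying set \<open>topspace T\<close>. Points of the
  \<open>n\<close>-th power are lists of length \<open>n\<close>, so that different powers are disjoint and a structure
  is literally one collection of subsets of the various powers.
\<close>

definition power_set :: "'a topology \<Rightarrow> nat \<Rightarrow> 'a list set" where
  "power_set T n = {v. length v = n \<and> set v \<subseteq> topspace T}"

text \<open>
  The product topology, transported from extensional functions on \<open>{..<n}\<close> to lists.
\<close>

definition power_topology :: "'a topology \<Rightarrow> nat \<Rightarrow> 'a list topology" where
  "power_topology T n =
     pullback_topology (power_set T n) (\<lambda>v. \<lambda>i\<in>{..<n}. v ! i) (product_topology (\<lambda>_. T) {..<n})"

lemma topspace_power_topology [simp]: "topspace (power_topology T n) = power_set T n"
  by (auto simp: power_topology_def topspace_pullback_topology power_set_def subset_iff)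

text \<open>
  In the second condition \<open>idx\<close> is the finite (nonempty) sequence of indices and \<open>v\<close> the family
  of points, of which only the members with an index occurring in \<open>idx\<close> matter.
\<close>

definition structured_space :: "'a topology \<Rightarrow> 'a list set set \<Rightarrow> bool" where
  "structured_space T \<S> \<longleftrightarrow>
     \<S> \<subseteq> (\<Union>n\<in>{1..}. Pow (power_set T n)) \<and>
     (\<forall>n\<ge>1. \<forall>S\<in>\<S>. S \<subseteq> power_set T n \<longrightarrow> power_topology T n closure_of S \<in> \<S>) \<and>
     (\<forall>idx :: nat list. idx \<noteq> [] \<longrightarrow> {map v idx |v. v \<in> set idx \<rightarrow> topspace T} \<in> \<S>)"

definition oplus :: "('a \<Rightarrow> 'a) list \<Rightarrow> 'a list \<Rightarrow> 'a list" where
  "oplus fs v = map2 (\<lambda>f x. f x) fs v"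

text \<open>
  Maps from H to itself are represented by functions that are \<open>undefined\<close> outside
  \<open>topspace T\<close>, so that equality of functions is equality of maps on H.
\<close>

definition Fun :: "'a topology \<Rightarrow> ('a \<Rightarrow> 'a) set" where
  "Fun T = {X \<in> extensional (topspace T). continuous_map T T X}"

definition id_map :: "'a topology \<Rightarrow> 'a \<Rightarrow> 'a" where
  "id_map T = (\<lambda>x\<in>topspace T. x)"

text \<open>
  Pointwise convergence: the topology induced from the product of copies of \<open>T\<close> indexed by
  the points of H.
\<close>

definition Fun_topology :: "'a topology \<Rightarrow> ('a \<Rightarrow> 'a) topology" where
  "Fun_topology T = subtopology (product_topology (\<lambda>_. T) (topspace T)) (Fun T)"

lemma topspace_Fun_topology [simp]: "topspace (Fun_topology T) = Fun T"
  by (auto simp: Fun_topology_def Fun_def PiE_def continuous_map_def)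

definition End :: "'a topology \<Rightarrow> 'a list set set \<Rightarrow> ('a \<Rightarrow> 'a) set" where
  "End T \<S> =
     {X \<in> Fun T. \<forall>m n. \<forall>S\<in>\<S>. S \<subseteq> power_set T (m + n + 1) \<longrightarrow>
        oplus (replicate m (id_map T) @ [X] @ replicate n (id_map T)) ` S \<in> \<S>}"

definition jointly_invariant :: "nat \<Rightarrow> ('a \<Rightarrow> 'a) set \<Rightarrow> 'a list set \<Rightarrow> bool" where
  "jointly_invariant m \<X> S \<longleftrightarrow> (\<forall>X\<in>\<X>. oplus (replicate m X) ` S \<subseteq> S)"

definition equi_invariants :: "'a topology \<Rightarrow> ('a \<Rightarrow> 'a) set \<Rightarrow> ('a \<Rightarrow> 'a) set" where
  "equi_invariants T \<X> =
     {Y \<in> Fun T. \<forall>m\<ge>1. \<forall>S. closedin (power_topology T m) S \<and> jointly_invariant m \<X> S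
        \<longrightarrow> jointly_invariant m {Y} S}"

end

theory Submission
  imports Defs
begin

text \<open>
  The two inclusions rest on one device: a basic neighbourhood in the topology of pointwise
  convergence only sees the values of a map at finitely many points, that is, at one point \<open>v\<close> of
  some finite power, through the evaluation \<open>X \<mapsto> X\<^sup>\<oplus>\<^sup>n v\<close>.

  Evaluation at \<open>v\<close> is continuous, so a map in the closure of \<open>\<B>\<close> sends \<open>v\<close> into the closure of the
  orbit of \<open>v\<close>. If \<open>v\<close> lies in a closed jointly invariant set, then that set contains the closure
  of the orbit; hence limits of \<open>\<B>\<close> are equi-invariants
  (\<open>closure_of_subset_equi_invariants\<close>).

  Conversely, since \<open>\<B>\<close> is closed under composition and consists of continuous maps, the closure of
  an orbit is itself jointly invariant (\<open>jointly_invariant_closure_of_orbit\<close>), and it contains \<open>v\<close>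
  because \<open>\<B>\<close> contains the identity. An equi-invariant \<open>Y\<close> therefore sends \<open>v\<close> into the closure of
  its orbit, which says that some member of \<open>\<B>\<close> is as close to \<open>Y\<close> at the entries of \<open>v\<close> as desired
  (\<open>equi_invariants_subset_closure_of\<close>). The last claim holds because a closed set that contains
  \<open>\<B>\<close> contains its closure.
\<close>

section \<open>Coordinatewise continuity in the finite powers\<close>

lemma oplus_replicate: "length v = n \<Longrightarrow> oplus (replicate n X) v = map X v"
  unfolding oplus_def by (rule nth_equalityI) auto

lemma jointly_invariant_iff:
  assumes "S \<subseteq> power_set T n"
  shows "jointly_invariant n \<X> S \<longleftrightarrow> (\<forall>X\<in>\<X>. \<forall>v\<in>S. map X v \<in> S)"
proof -
  have "oplus (replicate n X) v = map X v" if "v \<in> S" for X v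
    using that assms by (intro oplus_replicate) (auto simp: power_set_def)
  then show ?thesis
    by (auto simp: jointly_invariant_def image_subset_iff)
qed

lemma continuous_map_nth:
  assumes "i < n"
  shows "continuous_map (power_topology T n) T (\<lambda>v. v ! i)"
proof -
  have "continuous_map (power_topology T n) T ((\<lambda>x. x i) \<circ> (\<lambda>v. \<lambda>i\<in>{..<n}. v ! i))"
    unfolding power_topology_def using assms
    by (intro continuous_map_pullback continuous_map_product_projection) auto
  then show ?thesis
    using assms by (simp add: o_def)
qed

lemma continuous_map_into_power_topology:
  assumes into: "\<And>z. z \<in> topspace Z \<Longrightarrow> g z \<in> power_set T n"
    and coord: "\<And>i. i < n \<Longrightarrow> continuous_map Z T (\<lambda>z. g z ! i)"
  shows "continuous_map Z (power_topology T n) g"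
  unfolding power_topology_def
proof (rule continuous_map_pullback')
  show "continuous_map Z (product_topology (\<lambda>_. T) {..<n}) ((\<lambda>v. \<lambda>i\<in>{..<n}. v ! i) \<circ> g)"
    using coord by (auto simp: continuous_map_componentwise o_def)
  show "topspace Z \<subseteq> g -` power_set T n"
    using into by auto
qed

lemma continuous_map_map:
  assumes "continuous_map T T X"
  shows "continuous_map (power_topology T n) (power_topology T n) (map X)"
proof (rule continuous_map_into_power_topology)
  show "map X v \<in> power_set T n" if "v \<in> topspace (power_topology T n)" for v
    using that continuous_map_image_subset_topspace[OF assms] by (auto simp: power_set_def)
  show "continuous_map (power_topology T n) T (\<lambda>v. map X v ! i)" if "i < n" for i
  proof (rule continuous_map_eq)
    show "continuous_map (power_topology T n) T (X \<circ> (\<lambda>v. v ! i))"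
      by (rule continuous_map_compose[OF continuous_map_nth[OF that] assms])
  qed (use that in \<open>auto simp: power_set_def\<close>)
qed

lemma continuous_map_evaluation:
  assumes "v \<in> power_set T n"
  shows "continuous_map (Fun_topology T) (power_topology T n) (\<lambda>X. map X v)"
proof (rule continuous_map_into_power_topology)
  show "map X v \<in> power_set T n" if "X \<in> topspace (Fun_topology T)" for X
    using that assms continuous_map_image_subset_topspace[of T T X]
    by (auto simp: power_set_def Fun_def)
  show "continuous_map (Fun_topology T) T (\<lambda>X. map X v ! i)" if "i < n" for i
  proof -
    have "v ! i \<in> topspace T" "length v = n"
      using assms that by (auto simp: power_set_def)
    then show ?thesis
      using that unfolding Fun_topology_def
      by (auto intro!: continuous_map_from_subtopology continuous_map_product_projection)
  qed
qed

lemma openin_power_topology_box: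
  assumes "\<And>i. i < n \<Longrightarrow> openin T (U i)"
  shows "openin (power_topology T n) {v \<in> power_set T n. \<forall>i<n. v ! i \<in> U i}"
proof -
  have "openin (power_topology T n) {v \<in> power_set T n. v ! i \<in> U i}" if "i < n" for i
    using openin_continuous_map_preimage[OF continuous_map_nth[OF that] assms[OF that]] by simp
  then have "openin (power_topology T n)
      ((\<Inter>i\<in>{..<n}. {v \<in> power_set T n. v ! i \<in> U i}) \<inter> topspace (power_topology T n))"
    by (intro openin_INT) auto
  moreover have "(\<Inter>i\<in>{..<n}. {v \<in> power_set T n. v ! i \<in> U i}) \<inter> topspace (power_topology T n)
      = {v \<in> power_set T n. \<forall>i<n. v ! i \<in> U i}"
    by auto
  ultimately show ?thesis by simp
qed

section \<open>Limits are equi-invariants\<close>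

text \<open>
  Evaluation at a point \<open>v\<close> of a closed jointly invariant set \<open>S\<close> maps \<open>\<B>\<close> into \<open>S\<close>, so by
  continuity it maps the closure of \<open>\<B>\<close> into the closed set \<open>S\<close>.
\<close>

lemma closure_of_subset_equi_invariants:
  "Fun_topology T closure_of \<B> \<subseteq> equi_invariants T \<B>"
proof
  fix Y assume Y: "Y \<in> Fun_topology T closure_of \<B>"
  have "jointly_invariant m {Y} S"
    if S: "closedin (power_topology T m) S" and inv: "jointly_invariant m \<B> S" for m S
  proof -
    have sub: "S \<subseteq> power_set T m"
      using closedin_subset[OF S] by simp
    have "map Y v \<in> S" if "v \<in> S" for v
    proof -
      have "continuous_map (Fun_topology T) (power_topology T m) (\<lambda>X. map X v)"
        using that sub by (intro continuous_map_evaluation) auto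
      then have "(\<lambda>X. map X v) ` (Fun_topology T closure_of \<B>)
          \<subseteq> power_topology T m closure_of ((\<lambda>X. map X v) ` \<B>)"
        by (rule continuous_map_image_closure_subset)
      also have "\<dots> \<subseteq> S"
        using inv that by (intro closure_of_minimal[OF _ S]) (auto simp: jointly_invariant_iff[OF sub])
      finally show ?thesis
        using Y by auto
    qed
    then show ?thesis
      by (simp add: jointly_invariant_iff[OF sub])
  qed
  moreover have "Y \<in> Fun T"
    using Y closure_of_subset_topspace[of "Fun_topology T" \<B>] by auto
  ultimately show "Y \<in> equi_invariants T \<B>"
    by (simp add: equi_invariants_def)
qed

section \<open>Equi-invariants are limits\<close>

text \<open>
  Closure under composition makes the orbit of \<open>v\<close> invariant, and a continuous map that preserves
  a set also preserves its closure.
\<close>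

lemma jointly_invariant_closure_of_orbit:
  assumes "\<B> \<subseteq> Fun T"
    and comp: "\<And>X Y. X \<in> \<B> \<Longrightarrow> Y \<in> \<B> \<Longrightarrow> compose (topspace T) X Y \<in> \<B>"
    and v: "v \<in> power_set T n"
  shows "jointly_invariant n \<B> (power_topology T n closure_of ((\<lambda>X. map X v) ` \<B>))"
proof -
  let ?O = "(\<lambda>X. map X v) ` \<B>"
  have "map X w \<in> power_topology T n closure_of ?O"
    if X: "X \<in> \<B>" and w: "w \<in> power_topology T n closure_of ?O" for X w
  proof -
    have "map X (map Y v) = map (compose (topspace T) X Y) v" for Y
      using v by (auto simp: power_set_def compose_def)
    then have "map X ` ?O \<subseteq> ?O"
      using comp[OF X] by auto
    moreover have "continuous_map T T X"
      using X assms(1) by (auto simp: Fun_def)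
    then have "map X ` (power_topology T n closure_of ?O) \<subseteq> power_topology T n closure_of (map X ` ?O)"
      by (intro continuous_map_image_closure_subset continuous_map_map)
    ultimately show ?thesis
      using w closure_of_mono by blast
  qed
  moreover have "power_topology T n closure_of ?O \<subseteq> power_set T n"
    using closure_of_subset_topspace[of "power_topology T n" ?O] by simp
  ultimately show ?thesis
    by (simp add: jointly_invariant_iff)
qed

text \<open>
  A basic neighbourhood of an equi-invariant \<open>Y\<close> constrains only finitely many values. Listing the
  points concerned as \<open>v\<close>, the closure of the orbit of \<open>v\<close> is a closed jointly invariant set
  containing \<open>v\<close>, hence also containing the image of \<open>v\<close> under \<open>Y\<close>; so the orbit meets the box
  that the neighbourhood prescribes around this image.
\<close>

lemma equi_invariants_subset_closure_of:
  assumes B: "\<B> \<subseteq> Fun T"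
    and id: "id_map T \<in> \<B>"
    and comp: "\<And>X Y. X \<in> \<B> \<Longrightarrow> Y \<in> \<B> \<Longrightarrow> compose (topspace T) X Y \<in> \<B>"
  shows "equi_invariants T \<B> \<subseteq> Fun_topology T closure_of \<B>"
proof
  fix Y assume Y: "Y \<in> equi_invariants T \<B>"
  then have YF: "Y \<in> Fun T"
    by (simp add: equi_invariants_def)
  have "\<exists>X\<in>\<B>. X \<in> W" if "Y \<in> W" and W: "openin (Fun_topology T) W" for W
  proof -
    obtain V where V: "openin (product_topology (\<lambda>_. T) (topspace T)) V" "W = V \<inter> Fun T"
      using W by (auto simp: Fun_topology_def openin_subtopology)
    then obtain U where fin: "finite {x \<in> topspace T. U x \<noteq> topspace T}"
      and op: "\<And>x. x \<in> topspace T \<Longrightarrow> openin T (U x)"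
      and YU: "Y \<in> PiE (topspace T) U" and UV: "PiE (topspace T) U \<subseteq> V"
      using \<open>Y \<in> W\<close> by (auto simp: openin_product_topology_alt)
    obtain v where v: "set v = {x \<in> topspace T. U x \<noteq> topspace T}"
      using finite_list[OF fin] by blast
    have "\<exists>X\<in>\<B>. \<forall>x\<in>set v. X x \<in> U x"
    proof (cases "v = []")
      case True
      (* Invariant sets live in positive powers only, but here any member of the family will do. *)
      then show ?thesis using id by auto
    next
      case False
      let ?n = "length v"
      let ?C = "power_topology T ?n closure_of ((\<lambda>X. map X v) ` \<B>)"
      let ?box = "{w \<in> power_set T ?n. \<forall>i<?n. w ! i \<in> U (v ! i)}"
      have vn: "v \<in> power_set T ?n"
        using v by (auto simp: power_set_def)
      have into: "map X v \<in> power_set T ?n" if "X \<in> Fun T" for X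
        using continuous_map_image_subset_topspace[of T T X] that vn
        by (auto simp: power_set_def Fun_def)
      have "v = map (id_map T) v"
        using vn by (auto simp: power_set_def id_map_def intro!: map_idI[symmetric])
      then have "v \<in> (\<lambda>X. map X v) ` \<B>"
        using id by blast
      then have vC: "v \<in> ?C"
        using into B by (auto intro!: closure_of_subset[THEN subsetD])
      have "jointly_invariant ?n \<B> ?C"
        using B comp vn by (rule jointly_invariant_closure_of_orbit)
      moreover have "?n \<ge> 1"
        using False by (cases v) auto
      ultimately have "jointly_invariant ?n {Y} ?C"
        using Y by (auto simp: equi_invariants_def)
      moreover have "?C \<subseteq> power_set T ?n"
        using closure_of_subset_topspace[of "power_topology T ?n"] by simp
      ultimately have "map Y v \<in> ?C"
        using vC by (simp add: jointly_invariant_iff)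
      moreover have "openin (power_topology T ?n) ?box"
        using vn by (intro openin_power_topology_box op) (auto simp: power_set_def)
      moreover have "Y (v ! i) \<in> U (v ! i)" if "i < ?n" for i
      proof (rule PiE_mem[OF YU])
        show "v ! i \<in> topspace T"
          using nth_mem[OF that] unfolding v by simp
      qed
      then have "map Y v \<in> ?box"
        using into[OF YF] by simp
      ultimately have "\<exists>w. w \<in> (\<lambda>X. map X v) ` \<B> \<and> w \<in> ?box"
        by (simp only: in_closure_of)
      then obtain X where X: "X \<in> \<B>" "map X v \<in> ?box"
        by (elim exE conjE imageE) simp
      then have "\<forall>x\<in>set v. X x \<in> U x"
        by (auto simp: in_set_conv_nth)
      then show ?thesis
        using X(1) by (rule bexI)
    qed
    then obtain X where X: "X \<in> \<B>" "\<And>x. x \<in> set v \<Longrightarrow> X x \<in> U x"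
      by blast
    have XF: "X \<in> extensional (topspace T)" "continuous_map T T X"
      using X(1) B by (auto simp: Fun_def)
    have "X x \<in> U x" if "x \<in> topspace T" for x
    proof (cases "U x = topspace T")
      case True
      then show ?thesis
        using continuous_map_image_subset_topspace[OF XF(2)] that by auto
    next
      case False
      then show ?thesis using X(2) v that by simp
    qed
    then have "X \<in> PiE (topspace T) U"
      using XF(1) by (simp add: PiE_iff)
    then show ?thesis
      using X(1) B UV V(2) by blast
  qed
  then show "Y \<in> Fun_topology T closure_of \<B>"
    using YF by (auto simp: in_closure_of)
qed

section \<open>The closure as the set of equi-invariants\<close>

theorem theorem2p15:
  fixes T :: "'a topology"
    and \<S> :: "'a list set set"
    and \<B> :: "('a \<Rightarrow> 'a) set"
  assumes "structured_space T \<S>"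
    and "\<B> \<subseteq> End T \<S>"
    and "id_map T \<in> \<B>"
    and "\<And>X Y. X \<in> \<B> \<Longrightarrow> Y \<in> \<B> \<Longrightarrow> compose (topspace T) X Y \<in> \<B>"
    and "\<And>n v. n \<ge> 1 \<Longrightarrow> v \<in> power_set T n \<Longrightarrow> {oplus (replicate n X) v |X. X \<in> \<B>} \<in> \<S>"
  shows "Fun_topology T closure_of \<B> = equi_invariants T \<B> \<and>
    (closedin (Fun_topology T) (End T \<S>) \<longrightarrow> equi_invariants T \<B> \<subseteq> End T \<S>)"
proof -
  have B: "\<B> \<subseteq> Fun T"
    using assms(2) by (auto simp: End_def)
  have "Fun_topology T closure_of \<B> \<subseteq> equi_invariants T \<B>"
    by (rule closure_of_subset_equi_invariants)
  then have eq: "Fun_topology T closure_of \<B> = equi_invariants T \<B>"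
    using equi_invariants_subset_closure_of[OF B assms(3,4)] by (rule subset_antisym)
  moreover have "equi_invariants T \<B> \<subseteq> End T \<S>" if "closedin (Fun_topology T) (End T \<S>)"
    using closure_of_minimal[OF assms(2) that] eq by simp
  ultimately show ?thesis
    by blast
qed

end
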